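(* Let $t$ be a strictly monotone aggregation function with $m$ arguments. Let $\mathbf{D}$ be the class of all databases (with $m$ sorted lists) that satisfy the distinctness property. Let $\mathbf{A}$ be the class of all algorithms that correctly find the top $k$ answers for $t$ for every database in $\mathbf{D}$. Then the threshold algorithm TA is instance optimal over $\mathbf{A}$ and $\mathbf{D}$.
   Context: Setting: fix positive integers $m$ and $k$ (treated as constants). A database consists of a finite set of $N\ge k$ objects; each object $R$ has $m$ grades (fields) $x_1,\dots,x_m\in[0,1]$. It is presented as $m$ sorted lists $L_1,\dots,L_m$ of length $N$; list $L_i$ contains one entry $(R,x_i)$ for each object $R$, where $x_i$ is the $i$th grade of $R$, in descending order of $x_i$. A database satisfies the distinctness property if for each $i$ no two objects have the same grade in list $L_i$. An aggregation function is a fixed function $t:[0,1]^m\to[0,\infty)$, monotone in the sense that $t(x_1,\dots,x_m)\le t(x_1',\dots,x_m')$ whenever $x_i\le x_i'$ for every $i$; the overall grade of $R$ is $t(R)=t(x_1,\dots,x_m)$. A (monotone) $t$ is strictly monotone if moreover $t(x_1,\dots,x_m)<t(x_1',\dots,x_m')$ whenever $x_i<x_i'$ for every $i$. The top $k$ answers are $k$ objects with the highest overall grades (ties broken arbitrarily), each along with its overall grade. Access and cost: an algorithm obtains information about the database only by sorted access (reading the next entry of some list, proceeding sequentially from the top) and random access (requesting the grade of a given object in a given list, obtained in one step; the object may be one not previously seen). Internal computation is free. With $s$ sorted and $r$ random accesses the middleware cost is $s c_S+r c_R$, where $c_S,c_R>0$ are fixed constants; $cost(\mathcal A,\mathcal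 D)$ is the middleware cost of algorithm $\mathcal A$ on database $\mathcal D$. Instance optimality: algorithm $\mathcal B$ is instance optimal over $\mathbf A$ and $\mathbf D$ if $\mathcal B\in\mathbf A$ and there are constants $c,c'$ such that $cost(\mathcal B,\mathcal D)\le c\cdot cost(\mathcal A,\mathcal D)+c'$ for every $\mathcal A\in\mathbf A$ and $\mathcal D\in\mathbf D$. Algorithm TA: (1) Do sorted access in parallel to each of the $m$ lists (top entry of each list, then second entry of each list, and so on). As an object $R$ is seen under sorted access in some list, do random access to the other lists to find all its grades, and compute $t(R)$. If this grade is one of the $k$ highest seen, remember $R$ and $t(R)$ (ties broken arbitrarily, only $k$ objects remembered). (2) For each $i$ let $\underline{x}_i$ be the grade of the last object seen under sorted access in $L_i$, and let the threshold value be $\tau=t(\underline{x}_1,\dots,\underline{x}_m)$. As soon as at least $k$ objects have been seen whose grade is at least $\tau$, halt. (3) Output the $k$ seen objects with highest grades, with their grades. *)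

theory Defs
  imports Complex_Main
begin

section \<open>Databases and aggregation functions\<close>

text \<open>A database is the list of its sorted lists. Lists and fields are numbered from 0, and
  \<open>'o\<close> is the type of potential objects. The object set is the common set of names occurring
  in the lists, so for \<open>m \<ge> 1\<close> the set \<open>S\<close> below is determined by the database.\<close>

type_synonym 'o database = "('o \<times> real) list list"

definition objects :: "'o database \<Rightarrow> 'o set" where
  "objects D = (\<Union>L\<in>set D. fst ` set L)"

definition is_database :: "nat \<Rightarrow> nat \<Rightarrow> 'o database \<Rightarrow> bool" where
  "is_database m k D \<longleftrightarrow> length D = m \<and>
     (\<exists>S. finite S \<and> card S \<ge> k \<and>
        (\<forall>L\<in>set D. distinct (map fst L) \<and> fst ` set L = S \<and>
                    snd ` set L \<subseteq> {0..1} \<and> sorted_wrt (\<ge>) (map snd L)))"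

definition distinctness_property :: "'o database \<Rightarrow> bool" where
  "distinctness_property D \<longleftrightarrow> (\<forall>L\<in>set D. distinct (map snd L))"

definition overall_grade :: "(real list \<Rightarrow> real) \<Rightarrow> 'o database \<Rightarrow> 'o \<Rightarrow> real" where
  "overall_grade t D R = t (map (\<lambda>L. the (map_of L R)) D)"

definition grade_vectors :: "nat \<Rightarrow> real list set" where
  "grade_vectors m = {xs. length xs = m \<and> set xs \<subseteq> {0..1}}"

definition aggregation_function :: "nat \<Rightarrow> (real list \<Rightarrow> real) \<Rightarrow> bool" where
  "aggregation_function m t \<longleftrightarrow>
     (\<forall>xs\<in>grade_vectors m. 0 \<le> t xs) \<and>
     (\<forall>xs\<in>grade_vectors m. \<forall>ys\<in>grade_vectors m. list_all2 (\<le>) xs ys \<longrightarrow> t xs \<le> t ys)"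

definition strictly_monotone :: "nat \<Rightarrow> (real list \<Rightarrow> real) \<Rightarrow> bool" where
  "strictly_monotone m t \<longleftrightarrow>
     (\<forall>xs\<in>grade_vectors m. \<forall>ys\<in>grade_vectors m. list_all2 (<) xs ys \<longrightarrow> t xs < t ys)"

text \<open>\<open>top_k k S g Y\<close>: the set \<open>Y\<close> consists of \<open>k\<close> members of \<open>S\<close> with highest \<open>g\<close>-values;
  ties may be broken in any way.\<close>

definition top_k :: "nat \<Rightarrow> 'o set \<Rightarrow> ('o \<Rightarrow> real) \<Rightarrow> 'o set \<Rightarrow> bool" where
  "top_k k S g Y \<longleftrightarrow> Y \<subseteq> S \<and> finite Y \<and> card Y = k \<and> (\<forall>R\<in>Y. \<forall>R'\<in>S - Y. g R' \<le> g R)"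

definition graded :: "('o \<Rightarrow> real) \<Rightarrow> 'o set \<Rightarrow> ('o \<times> real) set" where
  "graded g Y = (\<lambda>R. (R, g R)) ` Y"


section \<open>Algorithms, runs and cost\<close>

datatype 'o access = Sorted_Access nat | Random_Access nat 'o

text \<open>Every access returns the entry read. The answer is \<open>None\<close> if there is no such entry: a
  sorted access past the end of the list, a random access to an object that is not in the
  database, or an access to a list that does not exist.\<close>

type_synonym 'o history = "('o access \<times> ('o \<times> real) option) list"

datatype 'o action = Access "'o access" | Halt "('o \<times> real) set"

text \<open>Since internal computation is free, a deterministic algorithm is a function from
  everything learned so far to the next action.\<close>

type_synonym 'o algorithm = "'o history \<Rightarrow> 'o action"

definition sorted_depth :: "nat \<Rightarrow> 'o history \<Rightarrow> nat" where
  "sorted_depth i h = length (filter (\<lambda>(a, e). a = Sorted_Access i) h)"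

fun answer :: "'o database \<Rightarrow> 'o history \<Rightarrow> 'o access \<Rightarrow> ('o \<times> real) option" where
  "answer D h (Sorted_Access i) =
     (if i < length D \<and> sorted_depth i h < length (D ! i)
      then Some (D ! i ! sorted_depth i h) else None)"
| "answer D h (Random_Access i R) =
     (if i < length D then map_option (Pair R) (map_of (D ! i) R) else None)"

text \<open>The history after at most \<open>n\<close> accesses; it stays constant once the algorithm halts.\<close>

primrec run :: "'o algorithm \<Rightarrow> 'o database \<Rightarrow> nat \<Rightarrow> 'o history" where
  "run A D 0 = []"
| "run A D (Suc n) =
     (case A (run A D n) of
        Access a \<Rightarrow> run A D n @ [(a, answer D (run A D n) a)]
      | Halt Y \<Rightarrow> run A D n)"

definition outputs :: "'o algorithm \<Rightarrow> 'o database \<Rightarrow> ('o \<times> real) set \<Rightarrow> bool" where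
  "outputs A D Y \<longleftrightarrow> (\<exists>n. A (run A D n) = Halt Y)"

definition correct_top_k ::
    "nat \<Rightarrow> (real list \<Rightarrow> real) \<Rightarrow> 'o database set \<Rightarrow> 'o algorithm \<Rightarrow> bool" where
  "correct_top_k k t DD A \<longleftrightarrow>
     (\<forall>D\<in>DD. \<exists>Y. top_k k (objects D) (overall_grade t D) Y \<and>
                  outputs A D (graded (overall_grade t D) Y))"

definition final_history :: "'o algorithm \<Rightarrow> 'o database \<Rightarrow> 'o history" where
  "final_history A D = run A D (LEAST n. \<exists>Y. A (run A D n) = Halt Y)"

definition num_sorted :: "'o history \<Rightarrow> nat" where
  "num_sorted h = length (filter (\<lambda>(a, e). \<exists>i. a = Sorted_Access i) h)"

definition num_random :: "'o history \<Rightarrow> nat" where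
  "num_random h = length (filter (\<lambda>(a, e). \<exists>i R. a = Random_Access i R) h)"

text \<open>The cost is only meaningful if \<open>A\<close> halts on \<open>D\<close>, which \<open>correct_top_k\<close> guarantees.\<close>

definition cost :: "real \<Rightarrow> real \<Rightarrow> 'o algorithm \<Rightarrow> 'o database \<Rightarrow> real" where
  "cost cS cR A D =
     real (num_sorted (final_history A D)) * cS + real (num_random (final_history A D)) * cR"

definition instance_optimal ::
    "real \<Rightarrow> real \<Rightarrow> 'o algorithm \<Rightarrow> 'o algorithm set \<Rightarrow> 'o database set \<Rightarrow> bool" where
  "instance_optimal cS cR B AA DD \<longleftrightarrow> B \<in> AA \<and>
     (\<exists>c c'. \<forall>A\<in>AA. \<forall>D\<in>DD. cost cS cR B D \<le> c * cost cS cR A D + c')"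


section \<open>The threshold algorithm\<close>

definition entries_read :: "nat \<Rightarrow> 'o history \<Rightarrow> ('o \<times> real) list" where
  "entries_read i h = [e. (a, Some e) \<leftarrow> h, a = Sorted_Access i]"

definition seen :: "nat \<Rightarrow> 'o history \<Rightarrow> 'o set" where
  "seen m h = (\<Union>i<m. fst ` set (entries_read i h))"

definition learned_grade :: "'o history \<Rightarrow> 'o \<Rightarrow> nat \<Rightarrow> real" where
  "learned_grade h R i =
     (SOME x. (Sorted_Access i, Some (R, x)) \<in> set h \<or> (Random_Access i R, Some (R, x)) \<in> set h)"

definition learned_overall :: "nat \<Rightarrow> (real list \<Rightarrow> real) \<Rightarrow> 'o history \<Rightarrow> 'o \<Rightarrow> real" where
  "learned_overall m t h R = t (map (learned_grade h R) [0..<m])"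

definition threshold :: "nat \<Rightarrow> (real list \<Rightarrow> real) \<Rightarrow> 'o history \<Rightarrow> real" where
  "threshold m t h = t (map (\<lambda>i. snd (last (entries_read i h))) [0..<m])"

text \<open>A round of TA advances every list by one entry. It consists of \<open>m\<close> blocks of \<open>m\<close> accesses
  each: block \<open>i\<close> is one sorted access to list \<open>i\<close> followed by random accesses to the other
  \<open>m - 1\<close> lists for the object just read, even if its grades are already known. The position
  within the round is determined by the number of accesses made.\<close>

definition TA_next :: "nat \<Rightarrow> 'o history \<Rightarrow> 'o access" where
  "TA_next m h =
     (let i = (length h div m) mod m; p = length h mod m in
      if p = 0 then Sorted_Access i
      else Random_Access (filter (\<lambda>j. j \<noteq> i) [0..<m] ! (p - 1))
                         (fst (the (snd (h ! (length h - p))))))"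

text \<open>The stopping rule is tested after each complete round. For \<open>k \<ge> 1\<close> it cannot hold before
  the first round, as no object has been seen.\<close>

definition TA_stops :: "nat \<Rightarrow> nat \<Rightarrow> (real list \<Rightarrow> real) \<Rightarrow> 'o history \<Rightarrow> bool" where
  "TA_stops m k t h \<longleftrightarrow> length h mod (m * m) = 0 \<and>
     k \<le> card {R \<in> seen m h. threshold m t h \<le> learned_overall m t h R}"

text \<open>\<open>is_TA m k t B\<close>: the algorithm \<open>B\<close> is TA with some way of breaking ties in the output.\<close>

definition is_TA :: "nat \<Rightarrow> nat \<Rightarrow> (real list \<Rightarrow> real) \<Rightarrow> 'o algorithm \<Rightarrow> bool" where
  "is_TA m k t B \<longleftrightarrow>
     (\<forall>h. if TA_stops m k t h
          then \<exists>Y. top_k k (seen m h) (learned_overall m t h) Y \<and>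
                   B h = Halt (graded (learned_overall m t h) Y)
          else B h = Access (TA_next m h))"

lemma top_k_exists:
  assumes "finite S" "k \<le> card S"
  shows "\<exists>Y. top_k k S g Y"
  using assms(2)
proof (induction k)
  case 0
  show ?case by (auto simp: top_k_def)
next
  case (Suc k)
  then obtain Y where Y: "top_k k S g Y" by auto
  then have "S - Y \<noteq> {}" and fin: "finite (S - Y)"
    using Suc.prems assms(1) by (auto simp: top_k_def dest: card_mono[rotated])
  then have "Max (g ` (S - Y)) \<in> g ` (S - Y)" by (intro Max_in) auto
  then obtain R where "R \<in> S - Y" "g R = Max (g ` (S - Y))" by (metis imageE)
  then have R: "R \<in> S - Y" "\<forall>R'\<in>S - Y. g R' \<le> g R"
    using fin by auto
  then have "top_k (Suc k) S g (insert R Y)"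
    using Y by (auto simp: top_k_def)
  then show ?case by blast
qed

lemma is_TA_exists: "\<exists>B. is_TA m k t B"
proof -
  have "\<exists>Y. top_k k (seen m h) (learned_overall m t h) Y" if "TA_stops m k t h" for h :: "'a history"
  proof (rule top_k_exists)
    show fin: "finite (seen m h)" by (simp add: seen_def)
    have "card {R \<in> seen m h. threshold m t h \<le> learned_overall m t h R} \<le> card (seen m h)"
      by (rule card_mono[OF fin]) auto
    with that show "k \<le> card (seen m h)" by (simp add: TA_stops_def)
  qed
  then have "is_TA m k t (\<lambda>h. if TA_stops m k t h
      then Halt (graded (learned_overall m t h)
                   (SOME Y. top_k k (seen m h) (learned_overall m t h) Y))
      else Access (TA_next m h) :: 'a action)"
    unfolding is_TA_def by simp (metis someI_ex)
  then show ?thesis by blast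
qed

end

theory Submission
  imports Defs
begin

text \<open>Let a correct algorithm halt on \<open>D\<close> after \<open>a\<close> accesses with answer set \<open>Y\<close>. If \<open>D\<close> has
  only \<open>O(a)\<close> objects, TA halts in time because it has then exhausted the lists. Otherwise some
  object \<open>V\<close> outside \<open>Y\<close> was never requested and occurs in no list above depth \<open>a + 2\<close>. Move
  it, in every list, between the entries at depths \<open>a + 1\<close> and \<open>a + 2\<close>, with a grade strictly
  between theirs (this is where distinctness is used). The algorithm cannot notice the change, so
  by correctness each member of \<open>Y\<close> has an overall grade at least that of the moved \<open>V\<close>, which
  by strict monotonicity exceeds the threshold at depth \<open>a + 2\<close>. Objects that TA has not seen by
  then do not exceed the threshold, so TA has seen all of \<open>Y\<close> and stops.\<close>

section \<open>Runs\<close>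

abbreviation halted :: "'o algorithm \<Rightarrow> 'o database \<Rightarrow> nat \<Rightarrow> bool" where
  "halted A D n \<equiv> \<exists>Y. A (run A D n) = Halt Y"

lemma run_halted:
  assumes "A (run A D n) = Halt Y" "n \<le> n'"
  shows "run A D n' = run A D n"
  using assms(2) by (induction n' rule: dec_induct) (use assms(1) in auto)

text \<open>Determinism: the first halt freezes the history, so any two halting times show the same
  action.\<close>

lemma outputs_unique:
  assumes "outputs A D Y" "outputs A D Z"
  shows "Y = Z"
proof -
  obtain n n' where halt: "A (run A D n) = Halt Y" "A (run A D n') = Halt Z"
    using assms unfolding outputs_def by blast
  have "run A D n = run A D n'"
  proof (cases "n \<le> n'")
    case True
    then show ?thesis using run_halted[of A D n Y n'] halt(1) by simp
  next
    case False
    then show ?thesis using run_halted[of A D n' Z n] halt(2) by simp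
  qed
  with halt show ?thesis by simp
qed

lemma run_Suc_not_halted:
  assumes "\<not> halted A D n"
  obtains a where "A (run A D n) = Access a"
    "run A D (Suc n) = run A D n @ [(a, answer D (run A D n) a)]"
proof (cases "A (run A D n)")
  case (Access a)
  then show thesis by (intro that[of a]) simp_all
next
  case (Halt Y)
  then show thesis using assms by blast
qed

lemma length_run:
  assumes "\<forall>n'<n. \<not> halted A D n'"
  shows "length (run A D n) = n"
  using assms
proof (induction n)
  case (Suc n)
  then have "\<not> halted A D n" by blast
  then show ?case using Suc by (elim run_Suc_not_halted) simp
qed simp

text \<open>Histories grow only at the end, so the state in which access \<open>q\<close> was chosen
  can be recovered from any later history.\<close>

lemma take_run:
  assumes "\<forall>n'<n. \<not> halted A D n'" "q \<le> n"
  shows "take q (run A D n) = run A D q"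
  using assms(2,1)
proof (induction n rule: dec_induct)
  case base
  then show ?case using length_run[of q A D] by simp
next
  case (step n)
  then have "\<not> halted A D n" "length (run A D n) = n" using length_run[of n A D] by auto
  then show ?case using step by (elim run_Suc_not_halted) simp
qed

lemma nth_run:
  assumes "\<forall>n'<n. \<not> halted A D n'" "q < n"
  obtains a where "A (run A D q) = Access a" "run A D n ! q = (a, answer D (run A D q) a)"
proof -
  have "\<not> halted A D q" using assms by blast
  then obtain a where a: "A (run A D q) = Access a"
      "run A D (Suc q) = run A D q @ [(a, answer D (run A D q) a)]"
    by (rule run_Suc_not_halted)
  have "run A D n ! q = take (Suc q) (run A D n) ! q" by simp
  also have "\<dots> = run A D (Suc q) ! q" using take_run[of n A D "Suc q"] assms by simp
  also have "\<dots> = (a, answer D (run A D q) a)"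
    using a(2) length_run[of q A D] assms by (simp add: nth_append)
  finally show thesis using a(1) that by blast
qed

lemma final_history_run:
  assumes "halted A D n"
  obtains n0 where "n0 \<le> n" "halted A D n0" "\<forall>n'<n0. \<not> halted A D n'"
    "final_history A D = run A D n0"
proof -
  let ?n0 = "LEAST n. halted A D n"
  show thesis
  proof (rule that[of ?n0])
    show "?n0 \<le> n" using assms by (rule Least_le)
    show "halted A D ?n0" using assms by (rule LeastI)
    show "\<forall>n'<?n0. \<not> halted A D n'" using not_less_Least by blast
    show "final_history A D = run A D ?n0" by (simp add: final_history_def)
  qed
qed

section \<open>Cost and number of accesses\<close>

lemma num_sorted_plus_num_random: "num_sorted h + num_random h = length h"
proof (induction h)
  case (Cons x h)
  then show ?case
    by (cases x; cases "fst x") (auto simp: num_sorted_def num_random_def)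
qed (simp add: num_sorted_def num_random_def)

text \<open>Together with \<open>length_le_cost\<close> this reduces instance optimality to counting
  accesses, at the price of the factor \<open>max cS cR / min cS cR\<close>.\<close>

lemma cost_le_length:
  "cost cS cR A D \<le> real (length (final_history A D)) * max cS cR"
proof -
  let ?h = "final_history A D"
  have "cost cS cR A D \<le> num_sorted ?h * max cS cR + num_random ?h * max cS cR"
    unfolding cost_def by (intro add_mono mult_left_mono) auto
  also have "\<dots> = real (num_sorted ?h + num_random ?h) * max cS cR" by (simp add: algebra_simps)
  finally show ?thesis by (simp add: num_sorted_plus_num_random)
qed

lemma length_le_cost:
  "real (length (final_history A D)) * min cS cR \<le> cost cS cR A D"
proof -
  let ?h = "final_history A D"
  have "real (length ?h) * min cS cR = real (num_sorted ?h + num_random ?h) * min cS cR"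
    by (simp add: num_sorted_plus_num_random)
  also have "\<dots> = num_sorted ?h * min cS cR + num_random ?h * min cS cR"
    by (simp add: algebra_simps)
  also have "\<dots> \<le> cost cS cR A D"
    unfolding cost_def by (intro add_mono mult_left_mono) auto
  finally show ?thesis .
qed

section \<open>What a history reveals about the database\<close>

lemma entries_read_append: "entries_read i (h @ h') = entries_read i h @ entries_read i h'"
  by (simp add: entries_read_def)

text \<open>Sorted accesses past the end of a list count in \<open>sorted_depth\<close> but return
  no entry; \<open>take\<close> absorbs the excess.\<close>

lemma entries_read_run:
  assumes "i < length D"
  shows "entries_read i (run A D n) = take (sorted_depth i (run A D n)) (D ! i)"
proof (induction n)
  case (Suc n)
  show ?case
  proof (cases "A (run A D n)")
    case (Access a)
    show ?thesis
    proof (cases "a = Sorted_Access i")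
      case True
      then show ?thesis using Suc Access assms
        by (auto simp: entries_read_append sorted_depth_def take_Suc_conv_app_nth entries_read_def)
    next
      case False
      then have "entries_read i [(a, e)] = []" for e
        by (cases e) (auto simp: entries_read_def)
      then show ?thesis using Suc Access False
        by (simp add: entries_read_append) (simp add: sorted_depth_def)
    qed
  qed (use Suc in simp)
qed (simp add: entries_read_def sorted_depth_def)

lemma answer_truthful:
  assumes "\<forall>L\<in>set D. distinct (map fst L)"
    and "answer D h a = Some (R, x)" "a = Sorted_Access i \<or> a = Random_Access i R'"
  shows "i < length D \<and> map_of (D ! i) R = Some x"
  using assms by (auto split: if_splits simp: map_of_eq_Some_iff) (metis nth_mem)+

text \<open>Names are distinct within a list, so all recorded answers agree and the
  \<open>SOME\<close> in \<open>learned_grade\<close> can only pick the true grade.\<close>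

lemma run_truthful:
  assumes "\<forall>L\<in>set D. distinct (map fst L)" "(a, Some (R, x)) \<in> set (run A D n)"
    and "a = Sorted_Access i \<or> a = Random_Access i R'"
  shows "i < length D \<and> map_of (D ! i) R = Some x"
  using assms(2)
proof (induction n)
  case (Suc n)
  show ?case
  proof (cases "A (run A D n)")
    case (Access b)
    then have "(a, Some (R, x)) \<in> set (run A D n) \<or> answer D (run A D n) a = Some (R, x)"
      using Suc.prems by auto
    then show ?thesis using Suc.IH answer_truthful[OF assms(1) _ assms(3)] by blast
  qed (use Suc in simp)
qed simp


section \<open>The rounds of the threshold algorithm\<close>

lemma is_databaseD:
  assumes "is_database m k D" "m \<ge> 1"
  shows "length D = m" "finite (objects D)" "k \<le> card (objects D)"
    "L \<in> set D \<Longrightarrow> distinct (map fst L)" "L \<in> set D \<Longrightarrow> fst ` set L = objects D"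
    "L \<in> set D \<Longrightarrow> snd ` set L \<subseteq> {0..1}" "L \<in> set D \<Longrightarrow> sorted_wrt (\<ge>) (map snd L)"
proof -
  obtain S where S: "length D = m" "finite S" "card S \<ge> k"
      "\<forall>L\<in>set D. distinct (map fst L) \<and> fst ` set L = S \<and>
                  snd ` set L \<subseteq> {0..1} \<and> sorted_wrt (\<ge>) (map snd L)"
    using assms unfolding is_database_def by blast
  from S(1) assms(2) have "set D \<noteq> {}" by auto
  with S(4) have "objects D = S" by (auto simp: objects_def)
  with S show "length D = m" "finite (objects D)" "k \<le> card (objects D)"
    "L \<in> set D \<Longrightarrow> distinct (map fst L)" "L \<in> set D \<Longrightarrow> fst ` set L = objects D"
    "L \<in> set D \<Longrightarrow> snd ` set L \<subseteq> {0..1}" "L \<in> set D \<Longrightarrow> sorted_wrt (\<ge>) (map snd L)"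
    by auto
qed

definition top_objects :: "'o database \<Rightarrow> nat \<Rightarrow> 'o set" where
  "top_objects D r = (\<Union>L\<in>set D. fst ` set (take r L))"

text \<open>The arguments of the threshold after \<open>r\<close> rounds. Taking \<open>last\<close>
  of a prefix remains meaningful when \<open>r\<close> exceeds the length of the lists; for
  \<open>r = 0\<close> it is \<open>last []\<close>, hence the conditions \<open>r \<ge> 1\<close>
  below.\<close>

definition bottom_grades :: "'o database \<Rightarrow> nat \<Rightarrow> real list" where
  "bottom_grades D r = map (\<lambda>L. snd (last (take r L))) D"

lemma is_TA_Halt:
  assumes "is_TA m k t B" "B h = Halt Z"
  obtains Y where "TA_stops m k t h" "top_k k (seen m h) (learned_overall m t h) Y"
    "Z = graded (learned_overall m t h) Y"
proof -
  have "if TA_stops m k t h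
      then \<exists>Y. top_k k (seen m h) (learned_overall m t h) Y \<and>
               B h = Halt (graded (learned_overall m t h) Y)
      else B h = Access (TA_next m h)"
    using assms(1) unfolding is_TA_def by blast
  then show thesis using that assms(2) by (auto split: if_splits)
qed

lemma is_TA_Access:
  assumes "is_TA m k t B" "B h = Access a"
  shows "a = TA_next m h"
proof -
  have "if TA_stops m k t h
      then \<exists>Y. top_k k (seen m h) (learned_overall m t h) Y \<and>
               B h = Halt (graded (learned_overall m t h) Y)
      else B h = Access (TA_next m h)"
    using assms(1) unfolding is_TA_def by blast
  then show ?thesis using assms(2) by (auto split: if_splits)
qed

section \<open>Overall grades compared with the threshold\<close>

locale ranking =
  fixes m k :: nat and t :: "real list \<Rightarrow> real" and D :: "'o database"
  assumes m_pos: "m \<ge> 1" and k_pos: "k \<ge> 1" and aggr: "aggregation_function m t"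
    and db: "is_database m k D"
begin

lemmas database = is_databaseD[OF db m_pos]

abbreviation g :: "'o \<Rightarrow> real" where "g \<equiv> overall_grade t D"

lemma map_of_object:
  assumes "L \<in> set D" "R \<in> objects D"
  obtains x where "map_of L R = Some x" "(R, x) \<in> set L" "x \<in> {0..1}"
proof -
  have "R \<in> fst ` set L" using assms database(5) by blast
  then obtain x where "(R, x) \<in> set L" by auto
  moreover from this have "map_of L R = Some x" "x \<in> {0..1}"
    using database(4,6) assms(1) by force+
  ultimately show thesis using that by blast
qed

lemma objects_card: "L \<in> set D \<Longrightarrow> length L = card (objects D)"
  using database(4,5) by (metis distinct_card length_map list.set_map)

lemma top_objects_subset: "top_objects D r \<subseteq> objects D"
  by (auto simp: top_objects_def objects_def dest: in_set_takeD)

lemma finite_top_objects: "finite (top_objects D r)"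
  by (simp add: top_objects_def)

lemma objects_nonempty: "L \<in> set D \<Longrightarrow> L \<noteq> []"
  using objects_card database(3) k_pos by force

lemma last_take_in:
  assumes "L \<in> set D" "r \<ge> 1"
  shows "last (take r L) \<in> set (take r L)"
  using assms objects_nonempty by (intro last_in_set) auto

lemma grades_object: "R \<in> objects D \<Longrightarrow> map (\<lambda>L. the (map_of L R)) D \<in> grade_vectors m"
  using database(1) by (auto simp: grade_vectors_def elim: map_of_object)

lemma bottom_grades_in:
  assumes "r \<ge> 1"
  shows "bottom_grades D r \<in> grade_vectors m"
proof -
  have "snd (last (take r L)) \<in> {0..1}" if "L \<in> set D" for L
    using in_set_takeD[OF last_take_in[OF that assms]] database(6)[OF that] by blast
  then show ?thesis using database(1) by (auto simp: grade_vectors_def bottom_grades_def)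
qed

lemma aggr_mono:
  assumes "xs \<in> grade_vectors m" "ys \<in> grade_vectors m" "list_all2 (\<le>) xs ys"
  shows "t xs \<le> t ys"
  using aggr assms by (auto simp: aggregation_function_def)

text \<open>In every list such an object lies in \<open>drop r L\<close>, so each of its grades is
  at most the last one read; monotonicity of \<open>t\<close> does the rest.\<close>

lemma unseen_below_threshold:
  assumes "r \<ge> 1" "R \<in> objects D - top_objects D r"
  shows "g R \<le> t (bottom_grades D r)"
  unfolding overall_grade_def
proof (rule aggr_mono[OF grades_object bottom_grades_in[OF assms(1)]])
  show "R \<in> objects D" using assms by blast
  show "list_all2 (\<le>) (map (\<lambda>L. the (map_of L R)) D) (bottom_grades D r)"
    unfolding bottom_grades_def list.rel_map
  \<comment> \<open>Both vectors are maps over \<open>D\<close>, so the componentwise comparison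
    reduces to a single list \<open>L\<close>.\<close>
  proof (intro list.rel_refl_strong)
    fix L assume L: "L \<in> set D"
    obtain x where x: "map_of L R = Some x" "(R, x) \<in> set L"
      using map_of_object L assms(2) by blast
    have "(R, x) \<notin> set (take r L)" using L assms(2) by (force simp: top_objects_def)
    moreover have "set L = set (take r L) \<union> set (drop r L)"
      by (metis append_take_drop_id set_append)
    ultimately have "(R, x) \<in> set (drop r L)" using x(2) by blast
    moreover have "sorted_wrt (\<ge>) (map snd (take r L @ drop r L))" using database(7)[OF L] by simp
    ultimately have "x \<le> snd (last (take r L))"
      using last_take_in[OF L assms(1)] unfolding map_append sorted_wrt_append by force
    then show "the (map_of L R) \<le> snd (last (take r L))" using x by simp
  qed
qed

text \<open>At full depth the threshold is built from the final, hence smallest, grades of the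
  lists. This makes TA stop once the lists are exhausted.\<close>

lemma bottom_below_all:
  assumes "R \<in> objects D"
  shows "t (bottom_grades D (card (objects D))) \<le> g R"
  unfolding overall_grade_def
proof (rule aggr_mono[OF bottom_grades_in grades_object[OF assms]])
  show "1 \<le> card (objects D)" using database(3) k_pos by simp
  show "list_all2 (\<le>) (bottom_grades D (card (objects D))) (map (\<lambda>L. the (map_of L R)) D)"
    unfolding bottom_grades_def list.rel_map
  proof (intro list.rel_refl_strong)
    fix L assume L: "L \<in> set D"
    obtain x where x: "map_of L R = Some x" "(R, x) \<in> set L"
      using map_of_object[OF L assms] by blast
    have split: "butlast L @ [last L] = L" using objects_nonempty[OF L] by simp
    have "sorted_wrt (\<ge>) (map snd (butlast L @ [last L]))"
      unfolding split by (rule database(7)[OF L])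
    then have *: "\<forall>e\<in>set (butlast L). snd (last L) \<le> snd e"
      unfolding map_append sorted_wrt_append by simp
    have "(R, x) \<in> set (butlast L @ [last L])" unfolding split by (rule x(2))
    then consider "(R, x) \<in> set (butlast L)" | "last L = (R, x)" by fastforce
    then have "snd (last L) \<le> x" using * by cases auto
    then show "snd (last (take (card (objects D)) L)) \<le> the (map_of L R)"
      using x objects_card[OF L] by simp
  qed
qed

end

text \<open>The state after \<open>r\<close> complete rounds. Halting is excluded only before time
  \<open>r * (m * m)\<close>, so the facts below also cover a history at which \<open>B\<close>
  halts.\<close>

locale TA_run = ranking m k t D for m k t and D :: "'o database" +
  fixes B :: "'o algorithm" and r :: nat
  assumes TA: "is_TA m k t B"
    and running: "\<forall>n < r * (m * m). \<not> halted B D n"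
begin

abbreviation h :: "'o history" where "h \<equiv> run B D (r * (m * m))"

lemma length_h: "length h = r * (m * m)"
  using length_run[OF running] .

lemma nth_h:
  assumes "q < r * (m * m)"
  shows "h ! q = (TA_next m (take q h), answer D (take q h) (TA_next m (take q h)))"
proof -
  obtain a where a: "B (run B D q) = Access a" "h ! q = (a, answer D (run B D q) a)"
    using nth_run[OF running assms] .
  have "a = TA_next m (run B D q)" using is_TA_Access[OF TA a(1)] .
  then show ?thesis using a(2) take_run[OF running] assms by simp
qed

text \<open>Block \<open>i\<close> of a round starts at offset \<open>m * i\<close>, and only the
  first access of a block is sorted.\<close>

lemma sorted_position_iff:
  assumes "q < r * (m * m)" "i < m"
  shows "fst (h ! q) = Sorted_Access i \<longleftrightarrow> q mod (m * m) = m * i"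
proof -
  have "fst (h ! q) = Sorted_Access i \<longleftrightarrow> q mod m = 0 \<and> q div m mod m = i"
    using assms by (simp add: nth_h TA_next_def Let_def length_h)
  also have "\<dots> \<longleftrightarrow> q mod (m * m) = m * i"
  proof
    assume "q mod m = 0 \<and> q div m mod m = i"
    then show "q mod (m * m) = m * i" by (simp add: mod_mult2_eq)
  next
    assume *: "q mod (m * m) = m * i"
    then have "q mod m = 0" by (metis mod_mod_cancel dvd_triv_left mod_mult_self1_is_0)
    with * show "q mod m = 0 \<and> q div m mod m = i" using m_pos by (simp add: mod_mult2_eq)
  qed
  finally show ?thesis .
qed

lemma sorted_depth_h:
  assumes "i < m"
  shows "sorted_depth i h = r"
proof -
  have "sorted_depth i h = card {q. q < length h \<and> fst (h ! q) = Sorted_Access i}"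
    by (simp add: sorted_depth_def length_filter_conv_card case_prod_beta)
  \<comment> \<open>Round \<open>s\<close> contributes exactly one sorted access to list
    \<open>i\<close>.\<close>
  also have "{q. q < length h \<and> fst (h ! q) = Sorted_Access i} =
      (\<lambda>s. s * (m * m) + m * i) ` {..<r}"
  proof (intro equalityI subsetI)
    fix q assume "q \<in> {q. q < length h \<and> fst (h ! q) = Sorted_Access i}"
    then have q: "q < r * (m * m)" "q mod (m * m) = m * i"
      using sorted_position_iff assms length_h by auto
    then have "q div (m * m) < r" by (simp add: less_mult_imp_div_less)
    moreover have "q = q div (m * m) * (m * m) + m * i"
      using q(2) by (metis div_mult_mod_eq)
    ultimately show "q \<in> (\<lambda>s. s * (m * m) + m * i) ` {..<r}" by blast
  next
    fix q assume "q \<in> (\<lambda>s. s * (m * m) + m * i) ` {..<r}"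
    then obtain s where s: "s < r" "q = s * (m * m) + m * i" by auto
    have less: "m * i < m * m" using assms m_pos by simp
    have "q < Suc s * (m * m)" using s(2) less by simp
    also have "\<dots> \<le> r * (m * m)" using s(1) by (intro mult_le_mono1) simp
    finally have "q < r * (m * m)" .
    moreover have "q mod (m * m) = m * i" using s(2) less by simp
    ultimately show "q \<in> {q. q < length h \<and> fst (h ! q) = Sorted_Access i}"
      using sorted_position_iff assms length_h by simp
  qed
  also have "card \<dots> = r" using m_pos by (subst card_image) (auto simp: inj_on_def)
  finally show ?thesis .
qed

lemma entries_read_h: "i < m \<Longrightarrow> entries_read i h = take r (D ! i)"
  using entries_read_run[of i D B] sorted_depth_h database(1) by simp

lemma seen_h: "seen m h = top_objects D r"
proof -
  have "seen m h = (\<Union>i<m. fst ` set (take r (D ! i)))"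
    unfolding seen_def by (intro SUP_cong) (auto simp: entries_read_h)
  moreover have "set D = (!) D ` {..<m}" using database(1) nth_image[of m D] by (simp add: atLeast0LessThan)
  ultimately show ?thesis by (simp add: top_objects_def)
qed

lemma threshold_h: "threshold m t h = t (bottom_grades D r)"
proof -
  have "map (\<lambda>i. snd (last (entries_read i h))) [0..<m] = bottom_grades D r"
    unfolding bottom_grades_def
    using entries_read_h database(1) by (intro nth_equalityI) simp_all
  then show ?thesis unfolding threshold_def by (rule arg_cong)
qed

text \<open>If \<open>R\<close> was read in list \<open>j\<close> at position \<open>q\<close>, the
  block starting at \<open>q\<close> also contains a random access for \<open>R\<close> to every
  other list. As all rounds are complete, no block is cut off.\<close>

lemma all_grades_learned:
  assumes "R \<in> seen m h" "i < m"
  shows "\<exists>x. (Sorted_Access i, Some (R, x)) \<in> set h \<or> (Random_Access i R, Some (R, x)) \<in> set h"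
proof -
  obtain j y where j: "j < m" and y: "(R, y) \<in> set (entries_read j h)"
    using assms(1) by (auto simp: seen_def)
  from y have "(Sorted_Access j, Some (R, y)) \<in> set h"
    by (auto simp: entries_read_def split: option.splits if_splits)
  then obtain q where q: "q < r * (m * m)" "h ! q = (Sorted_Access j, Some (R, y))"
    using length_h by (auto simp: in_set_conv_nth)
  show ?thesis
  proof (cases "i = j")
    case True
    then show ?thesis using \<open>(Sorted_Access j, Some (R, y)) \<in> set h\<close> by blast
  next
    case False
    let ?js = "filter (\<lambda>l. l \<noteq> j) [0..<m]"
    have "i \<in> set ?js" using False assms(2) by simp
    then obtain p where p: "p < length ?js" "?js ! p = i" unfolding in_set_conv_nth by blast
    \<comment> \<open>\<open>p\<close> is the rank of \<open>i\<close> among the lists other than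
      \<open>j\<close>. There are fewer than \<open>m\<close> of these, so position
      \<open>q + Suc p\<close> stays within the block of \<open>q\<close>.\<close>
    have "length ?js < length [0..<m]" using j by (intro length_filter_less[of j]) auto
    then have pm: "Suc p < m" using p(1) by simp
    have "q mod (m * m) = m * j" using sorted_position_iff[OF q(1) j] q(2) by simp
    \<comment> \<open>\<open>s\<close> is the number of the round and \<open>s * m + j\<close> that
      of the block.\<close>
    then obtain s where s: "q = m * (s * m + j)"
      by (metis div_mult_mod_eq distrib_left mult.assoc mult.commute)
    let ?q = "q + Suc p"
    have "q < r * m * m" using q(1) by (simp add: mult.assoc)
    then have "s * m + j < r * m" using s by (simp add: mult.commute)
    then have "Suc (s * m + j) * m \<le> r * m * m" by (intro mult_le_mono1) simp
    then have q': "?q < r * (m * m)" using s pm by (simp add: algebra_simps)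
    have qmod: "?q mod m = Suc p" using s pm by simp
    have "?q div m = s * m + j" using s pm by (intro div_nat_eqI) (simp_all add: algebra_simps)
    then have qdiv: "?q div m mod m = j" using j by simp
    have "TA_next m (take ?q h) = Random_Access (?js ! p) (fst (the (snd (take ?q h ! q))))"
      using q' qmod qdiv unfolding TA_next_def Let_def by (simp add: length_h del: add_Suc_right)
    also have "\<dots> = Random_Access i R" using p(2) q(2) by simp
    finally have "h ! ?q = (Random_Access i R, map_option (Pair R) (map_of (D ! i) R))"
      using nth_h[OF q'] assms(2) database(1) by simp
    moreover obtain x where "map_of (D ! i) R = Some x"
    proof (rule map_of_object)
      show "D ! i \<in> set D" using assms(2) database(1) by simp
      show "R \<in> objects D" using assms(1) seen_h top_objects_subset by blast
    qed blast
    ultimately have "h ! ?q = (Random_Access i R, Some (R, x))" by simp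
    then show ?thesis using q' length_h by (metis nth_mem)
  qed
qed

lemma learned_overall_h:
  assumes "R \<in> seen m h"
  shows "learned_overall m t h R = g R"
proof -
  have "learned_grade h R i = the (map_of (D ! i) R)" if "i < m" for i
  proof -
    have "(Sorted_Access i, Some (R, learned_grade h R i)) \<in> set h \<or>
        (Random_Access i R, Some (R, learned_grade h R i)) \<in> set h"
      unfolding learned_grade_def by (rule someI_ex) (rule all_grades_learned[OF assms that])
    then have "map_of (D ! i) R = Some (learned_grade h R i)"
      using run_truthful[of D] database(4) by blast
    then show ?thesis by simp
  qed
  then have "map (learned_grade h R) [0..<m] = map (\<lambda>L. the (map_of L R)) D"
    using database(1) by (intro nth_equalityI) simp_all
  then show ?thesis unfolding learned_overall_def overall_grade_def by (rule arg_cong)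
qed

text \<open>The rule that TA evaluates on learned data becomes a condition on \<open>D\<close> and
  \<open>r\<close> alone.\<close>

lemma TA_stops_h:
  "TA_stops m k t h \<longleftrightarrow> k \<le> card {R \<in> top_objects D r. t (bottom_grades D r) \<le> g R}"
proof -
  have "{R \<in> seen m h. threshold m t h \<le> learned_overall m t h R} =
      {R \<in> top_objects D r. t (bottom_grades D r) \<le> g R}"
    using learned_overall_h seen_h threshold_h by auto
  then show ?thesis unfolding TA_stops_def using length_h by simp
qed

text \<open>At a halt at least \<open>k\<close> seen objects reach the threshold, hence so do the
  \<open>k\<close> best seen ones, while unseen objects cannot exceed it.\<close>

lemma TA_answer:
  assumes "B h = Halt Z"
  obtains Y where "top_k k (objects D) g Y" "Z = graded g Y"
proof -
  obtain Y where stops: "TA_stops m k t h"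
    and Y: "top_k k (seen m h) (learned_overall m t h) Y" "Z = graded (learned_overall m t h) Y"
    using is_TA_Halt[OF TA assms] .
  then have Yseen: "Y \<subseteq> top_objects D r" and Yk: "finite Y" "card Y = k"
    by (auto simp: top_k_def seen_h)
  have Ymax: "g R' \<le> g R" if "R \<in> Y" "R' \<in> top_objects D r - Y" for R R'
    using Y(1) that Yseen learned_overall_h seen_h by (fastforce simp: top_k_def)
  let ?\<tau> = "t (bottom_grades D r)"
  let ?W = "{R \<in> top_objects D r. ?\<tau> \<le> g R}"
  have W: "k \<le> card ?W" using stops TA_stops_h by simp
  \<comment> \<open>Before the first round the threshold is unspecified; \<open>k \<ge> 1\<close>
    rules out a halt there.\<close>
  have "r \<ge> 1"
  proof (rule ccontr)
    assume "\<not> r \<ge> 1"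
    then have "r = 0" by simp
    then have "?W = {}" by (auto simp: top_objects_def)
    with W k_pos show False by simp
  qed
  have Y\<tau>: "?\<tau> \<le> g R" if "R \<in> Y" for R
  proof (rule ccontr)
    assume "\<not> ?\<tau> \<le> g R"
    \<comment> \<open>Every member of \<open>?W\<close> would have a higher overall grade than
      \<open>R\<close>, and would thus belong to \<open>Y\<close>, leaving too few of them.\<close>
    then have "?W \<subseteq> Y - {R}" using Ymax[OF that] by force
    then have "card ?W \<le> card (Y - {R})" using Yk(1) by (intro card_mono) auto
    also have "\<dots> < k" using Yk that by (metis card_Diff1_less)
    finally show False using W by simp
  qed
  have "g R' \<le> g R" if "R \<in> Y" "R' \<in> objects D - Y" for R R'
  proof (cases "R' \<in> top_objects D r")
    case True
    then show ?thesis using Ymax that by blast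
  next
    case False
    then have "g R' \<le> ?\<tau>" using unseen_below_threshold[OF \<open>r \<ge> 1\<close>] that by blast
    with Y\<tau>[OF that(1)] show ?thesis by simp
  qed
  then have "top_k k (objects D) g Y"
    using Yseen Yk top_objects_subset[of r] unfolding top_k_def by blast
  moreover have "Z = graded g Y"
    using Y(2) Yseen learned_overall_h seen_h by (auto simp: graded_def intro!: image_cong)
  ultimately show thesis using that by blast
qed

end

section \<open>Halting time and correctness of TA\<close>

context ranking
begin

text \<open>Without an earlier halt TA would complete \<open>r\<close> rounds, and
  \<open>TA_stops_h\<close> makes it halt right there.\<close>

lemma TA_halts_by:
  assumes "is_TA m k t B" "k \<le> card {R \<in> top_objects D r. t (bottom_grades D r) \<le> g R}"
  shows "\<exists>n \<le> r * (m * m). halted B D n"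
proof (rule ccontr)
  assume *: "\<not> ?thesis"
  then interpret TA_run m k t D B r
    using assms(1) by unfold_locales auto
  have "TA_stops m k t h" using TA_stops_h assms(2) by simp
  then have "halted B D (r * (m * m))" using TA unfolding is_TA_def by metis
  with * show False by blast
qed

lemma TA_halts_by_length:
  assumes "is_TA m k t B"
  shows "\<exists>n \<le> card (objects D) * (m * m). halted B D n"
proof (rule TA_halts_by[OF assms])
  let ?N = "card (objects D)"
  have "top_objects D ?N = objects D"
    unfolding top_objects_def objects_def using objects_card by (simp add: objects_def)
  then have "{R \<in> top_objects D ?N. t (bottom_grades D ?N) \<le> g R} = objects D"
    using bottom_below_all by auto
  then show "k \<le> card {R \<in> top_objects D ?N. t (bottom_grades D ?N) \<le> g R}"
    using database(3) by simp
qed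

lemma TA_correct:
  assumes "is_TA m k t B"
  shows "\<exists>Y. top_k k (objects D) g Y \<and> outputs B D (graded g Y)"
proof -
  obtain n where "halted B D n" using TA_halts_by_length[OF assms] by blast
  then obtain n0 where n0: "halted B D n0" "\<forall>n'<n0. \<not> halted B D n'"
    by (rule final_history_run)
  from n0(1) obtain Z where Z: "B (run B D n0) = Halt Z" by blast
  have "TA_stops m k t (run B D n0)"
    using is_TA_Halt[OF assms Z] by blast
  \<comment> \<open>The first halt comes after complete rounds, which makes \<open>TA_run\<close>
    applicable.\<close>
  then have "n0 mod (m * m) = 0" using length_run[OF n0(2)] by (simp add: TA_stops_def)
  then have "n0 = n0 div (m * m) * (m * m)" by (metis add.right_neutral div_mult_mod_eq)
  then obtain r where r: "n0 = r * (m * m)" by blast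
  interpret TA_run m k t D B r
    using assms n0(2) r by unfold_locales auto
  obtain Y where "top_k k (objects D) g Y" "Z = graded g Y"
    using TA_answer Z r by blast
  then show ?thesis using Z unfolding outputs_def by blast
qed

end


section \<open>Moving an object up\<close>

text \<open>Positions count from \<open>0\<close>; only \<open>0 < j\<close> is meaningful, since otherwise no entry above
  bounds the new grade.\<close>

definition promote :: "'o \<Rightarrow> nat \<Rightarrow> ('o \<times> real) list \<Rightarrow> ('o \<times> real) list" where
  "promote V j L = take j L @ (V, (snd (L ! (j - 1)) + snd (L ! j)) / 2) #
     filter (\<lambda>e. fst e \<noteq> V) (drop j L)"

context
  fixes L :: "('o \<times> real) list" and V :: 'o and j :: nat
  assumes names: "distinct (map fst L)" and decreasing: "sorted_wrt (>) (map snd L)"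
    and V_in: "V \<in> fst ` set L" and V_late: "V \<notin> fst ` set (take j L)"
    and j: "0 < j" "j < length L"
begin

lemma promote_set: "fst ` set (promote V j L) = fst ` set L"
proof -
  have "set L = set (take j L) \<union> set (drop j L)" by (metis append_take_drop_id set_append)
  then show ?thesis using V_in by (auto simp: promote_def)
qed

text \<open>By \<open>V_late\<close> the kept prefix is free of \<open>V\<close>, and the old entry
  of \<open>V\<close> is filtered out of the rest.\<close>

lemma promote_distinct: "distinct (map fst (promote V j L))"
proof -
  have "distinct (map fst (take j L @ drop j L))" using names by simp
  then have "distinct (map fst (take j L))" "distinct (map fst (drop j L))"
      "fst ` set (take j L) \<inter> fst ` set (drop j L) = {}"
    unfolding map_append distinct_append by simp_all
  then show ?thesis using V_late by (auto simp: promote_def distinct_map_filter)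
qed

text \<open>With \<open>promote_length\<close>, sorted accesses at depths below \<open>j\<close>
  cannot tell the two lists apart.\<close>

lemma promote_nth: "q < j \<Longrightarrow> promote V j L ! q = L ! q"
  using j by (simp add: promote_def nth_append)

lemma promote_length: "j < length (promote V j L)"
  using j by (simp add: promote_def)

lemma promote_map_of_V:
  "map_of (promote V j L) V = Some ((snd (L ! (j - 1)) + snd (L ! j)) / 2)"
  using promote_distinct by (intro map_of_is_SomeI) (simp_all add: promote_def)

lemma promote_map_of_other:
  assumes "R \<noteq> V"
  shows "map_of (promote V j L) R = map_of L R"
proof -
  have "map_of (filter (\<lambda>e. fst e \<noteq> V) xs) R = map_of xs R" for xs :: "('o \<times> real) list"
    using assms by (induction xs) auto
  then have "map_of (promote V j L) R = map_of (take j L @ drop j L) R"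
    using assms unfolding promote_def map_of_append by (simp add: map_add_def cong: option.case_cong)
  then show ?thesis by simp
qed

text \<open>Strict descent of \<open>L\<close> puts the midpoint strictly below all entries before
  \<open>j\<close> and strictly above all others.\<close>

lemma promote_decreasing: "sorted_wrt (>) (map snd (promote V j L))"
proof -
  let ?v = "(snd (L ! (j - 1)) + snd (L ! j)) / 2"
  have lt: "snd (L ! q) < snd (L ! p)" if "p < q" "q < length L" for p q
    using decreasing that by (simp add: sorted_wrt_iff_nth_less)
  have v: "snd (L ! j) < ?v" "?v < snd (L ! (j - 1))" using lt[of "j - 1" j] j by auto
  have up: "?v < snd e" if e: "e \<in> set (take j L)" for e
  proof -
    obtain p where p: "p < j" "e = L ! p" using e by (auto simp: in_set_conv_nth)
    have "j - 1 < length L" and "p < j - 1 \<or> p = j - 1" using p(1) j by linarith+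
    then have "snd (L ! (j - 1)) \<le> snd e" using lt[of p "j - 1"] p(2) by (auto intro: less_imp_le)
    then show ?thesis using v by simp
  qed
  have down: "snd e < ?v" if e: "e \<in> set (drop j L)" for e
  proof -
    obtain p where "p < length (drop j L)" "drop j L ! p = e"
      using e unfolding in_set_conv_nth by blast
    then have p: "j + p < length L" "e = L ! (j + p)" by auto
    then have "snd e \<le> snd (L ! j)" using lt[of j "j + p"] by (cases "p = 0") auto
    then show ?thesis using v by simp
  qed
  have "sorted_wrt (>) (map snd (take j L @ drop j L))" using decreasing by simp
  then have "sorted_wrt (>) (map snd (take j L))" "sorted_wrt (>) (map snd (drop j L))"
    unfolding map_append sorted_wrt_append by simp_all
  moreover have "snd e' < snd e" if "e \<in> set (take j L)" "e' \<in> set (drop j L)" for e e'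
    using up[OF that(1)] down[OF that(2)] by (rule less_trans[rotated])
  ultimately show ?thesis using up down
    by (simp add: promote_def sorted_wrt_append sorted_wrt_map sorted_wrt_filter del: split_paired_All)
qed

lemma promote_range:
  assumes "snd ` set L \<subseteq> {0..1}"
  shows "snd ` set (promote V j L) \<subseteq> {0..1}"
proof -
  have "L ! (j - 1) \<in> set L" "L ! j \<in> set L" using j by simp_all
  then have "snd (L ! (j - 1)) \<in> {0..1}" "snd (L ! j) \<in> {0..1}" using assms by blast+
  then show ?thesis using assms by (auto simp: promote_def dest: in_set_takeD in_set_dropD)
qed

end

lemma sorted_wrt_greater_if_distinct:
  fixes xs :: "'a :: linorder list"
  assumes "sorted_wrt (\<ge>) xs" "distinct xs"
  shows "sorted_wrt (>) xs"
  using assms by (induction xs) (auto simp: order.strict_iff_order)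

lemma sorted_wrt_greaterD:
  fixes xs :: "'a :: linorder list"
  assumes "sorted_wrt (>) xs"
  shows "sorted_wrt (\<ge>) xs" "distinct xs"
  using assms by (induction xs) (auto simp: less_imp_le)


section \<open>Instance optimality\<close>

context ranking
begin

text \<open>Supplies the assumptions of the \<open>promote\<close> lemmas for each single
  list.\<close>

lemma promotable:
  assumes "distinctness_property D" "V \<in> objects D" "V \<notin> top_objects D j"
    and "0 < j" "j < card (objects D)" "L \<in> set D"
  shows "distinct (map fst L)" "sorted_wrt (>) (map snd L)" "V \<in> fst ` set L"
    "V \<notin> fst ` set (take j L)" "0 < j" "j < length L"
proof -
  show "sorted_wrt (>) (map snd L)"
    using assms(1,6) database(7) by (simp add: distinctness_property_def sorted_wrt_greater_if_distinct)
  show "V \<notin> fst ` set (take j L)" using assms(3,6) unfolding top_objects_def by blast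
qed (use assms database(4,5) objects_card in simp_all)

lemma promote_database:
  assumes "distinctness_property D" "V \<in> objects D" "V \<notin> top_objects D j"
    and "0 < j" "j < card (objects D)"
  shows "is_database m k (map (promote V j) D) \<and> distinctness_property (map (promote V j) D)"
proof -
  have "\<forall>L\<in>set D. distinct (map fst (promote V j L)) \<and> fst ` set (promote V j L) = objects D \<and>
      snd ` set (promote V j L) \<subseteq> {0..1} \<and> sorted_wrt (>) (map snd (promote V j L))"
  proof
    fix L assume L: "L \<in> set D"
    note ready = promotable[OF assms L]
    show "distinct (map fst (promote V j L)) \<and> fst ` set (promote V j L) = objects D \<and>
        snd ` set (promote V j L) \<subseteq> {0..1} \<and> sorted_wrt (>) (map snd (promote V j L))"
      using promote_distinct[OF ready] promote_set[OF ready] promote_range[OF ready database(6)[OF L]]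
        promote_decreasing[OF ready] database(5)[OF L] by simp
  qed
  then show ?thesis
    unfolding is_database_def distinctness_property_def
    using database(1,2,3) by (auto intro!: exI[of _ "objects D"] dest: sorted_wrt_greaterD)
qed

text \<open>Fewer than \<open>a \<le> j\<close> accesses precede each step, so sorted accesses stay
  above the moved entry. Random accesses never ask for \<open>V\<close>, and all other objects keep
  their grades.\<close>

lemma run_promote:
  assumes "distinctness_property D" "V \<in> objects D" "V \<notin> top_objects D j"
    and "0 < j" "j < card (objects D)" "a \<le> j"
    and running: "\<forall>n<a. \<not> halted A D n"
    and unasked: "\<forall>i. Random_Access i V \<notin> fst ` set (run A D a)"
  shows "n \<le> a \<Longrightarrow> run A (map (promote V j) D) n = run A D n"
proof (induction n)
  case (Suc n)
  note L = promotable[OF assms(1-5)]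
  let ?h = "run A D n"
  have IH: "run A (map (promote V j) D) n = ?h" using Suc by simp
  have na: "n < a" using Suc.prems by simp
  obtain b where b: "A ?h = Access b" "run A D a ! n = (b, answer D ?h b)"
    using nth_run[OF running na] .
  have "length ?h = n" using length_run running na by (metis less_trans)
  then have depth: "sorted_depth i ?h < j" for i
    using na \<open>a \<le> j\<close> length_filter_le[of _ ?h] unfolding sorted_depth_def
    by (metis le_less_trans less_le_trans)
  have asked: "b \<in> fst ` set (run A D a)"
    using b(2) length_run[OF running] na by (metis fst_conv imageI nth_mem)
  have "answer (map (promote V j) D) ?h b = answer D ?h b"
  proof (cases b)
    case (Sorted_Access i)
    show ?thesis
    proof (cases "i < length D")
      case True
      then have "D ! i \<in> set D" by simp
      note Li = L[OF this]
      show ?thesis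
        using Sorted_Access True depth[of i] promote_nth[OF Li depth] promote_length[OF Li] Li(6)
        by simp
    qed (simp add: Sorted_Access)
  next
    case (Random_Access i R)
    then have "R \<noteq> V" using asked unasked by blast
    then have "map_of (promote V j (D ! i)) R = map_of (D ! i) R" if "i < length D"
      using promote_map_of_other L that by (metis nth_mem)
    then show ?thesis using Random_Access by simp
  qed
  then show ?case using IH b(1) by simp
qed simp

lemma output_above_threshold:
  assumes strict: "strictly_monotone m t" and distinctness: "distinctness_property D"
    and correct: "correct_top_k k t {D. is_database m k D \<and> distinctness_property D} A"
    and Y: "A (run A D a) = Halt (graded g Y)" and running: "\<forall>n<a. \<not> halted A D n"
    and V: "V \<in> objects D" "V \<notin> Y" "V \<notin> top_objects D (a + 2)"
      "\<forall>i. Random_Access i V \<notin> fst ` set (run A D a)"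
    and long: "a + 2 \<le> card (objects D)"
    and R: "R \<in> Y"
  shows "t (bottom_grades D (a + 2)) < g R"
proof -
  \<comment> \<open>The \<open>a\<close> accesses read at most positions below \<open>a\<close>. The
    new grade at position \<open>a + 1\<close> is the midpoint of the old grades at \<open>a\<close>
    and \<open>a + 1\<close>, the latter being the bottom grade at depth
    \<open>a + 2\<close>.\<close>
  let ?j = "a + 1"
  let ?D = "map (promote V ?j) D"
  have V': "V \<notin> top_objects D ?j"
    using V(3) set_take_subset_set_take[of ?j "a + 2"] by (force simp: top_objects_def)
  have j: "0 < ?j" "?j < card (objects D)" using long by simp_all
  note L = promotable[OF distinctness V(1) V' j]
  have D': "is_database m k ?D" "distinctness_property ?D"
    using promote_database[OF distinctness V(1) V'] long by auto
  interpret D': ranking m k t ?D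
    using m_pos k_pos aggr D'(1) by unfold_locales
  have "run A ?D a = run A D a"
    using run_promote[OF distinctness V(1) V' _ _ _ running V(4), of a] long by simp
  then have out: "outputs A ?D (graded g Y)" using Y unfolding outputs_def by metis
  obtain Y' where Y': "top_k k (objects ?D) D'.g Y'" "outputs A ?D (graded D'.g Y')"
    using correct D' unfolding correct_top_k_def by blast
  then have eq: "graded D'.g Y' = graded g Y" using out outputs_unique by metis
  moreover have "fst ` graded f X = X" for f and X :: "'o set"
    by (force simp: graded_def)
  ultimately have "Y' = Y" by metis
  \<comment> \<open>Outputs carry the grades, so their equality shows that \<open>R\<close> has the
    same overall grade in both databases.\<close>
  have "(R, g R) \<in> graded D'.g Y'" using eq R by (auto simp: graded_def)
  then have gR: "D'.g R = g R" by (auto simp: graded_def)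
  have "objects ?D = objects D"
    using promote_set[OF L] by (simp add: objects_def)
  then have "D'.g V \<le> D'.g R"
    using Y'(1) V(1,2) R \<open>Y' = Y\<close> by (auto simp: top_k_def)
  moreover have "t (bottom_grades D (a + 2)) < D'.g V"
  proof -
    have "list_all2 (<) (bottom_grades D (a + 2)) (map (\<lambda>L. the (map_of L V)) ?D)"
      unfolding bottom_grades_def list.rel_map
    proof (intro list.rel_refl_strong)
      fix L assume "L \<in> set D"
      note Li = L[OF this]
      have "last (take (a + 2) L) = L ! ?j" using Li(6) by (subst last_conv_nth) auto
      moreover have "snd (L ! ?j) < snd (L ! a)"
        using Li(2,6) by (simp add: sorted_wrt_iff_nth_less)
      ultimately show "snd (last (take (a + 2) L)) < the (map_of (promote V ?j L) V)"
        using promote_map_of_V[OF Li] by simp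
    qed
    moreover have "map (\<lambda>L. the (map_of L V)) ?D \<in> grade_vectors m"
      using D'.grades_object V(1) \<open>objects ?D = objects D\<close> by metis
    moreover have "bottom_grades D (a + 2) \<in> grade_vectors m" by (rule bottom_grades_in) simp
    ultimately show ?thesis
      using strict unfolding strictly_monotone_def overall_grade_def by blast
  qed
  ultimately show ?thesis using gR by simp
qed

lemma TA_halts_fast:
  assumes strict: "strictly_monotone m t" and distinctness: "distinctness_property D"
    and correct: "correct_top_k k t {D. is_database m k D \<and> distinctness_property D} A"
    and TA: "is_TA m k t B"
  shows "\<exists>n \<le> ((m + 1) * length (final_history A D) + 2 * m + k) * (m * m). halted B D n"
proof -
  obtain Y where Y: "top_k k (objects D) g Y" "outputs A D (graded g Y)"
    using correct db distinctness unfolding correct_top_k_def by blast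
  then obtain n where "halted A D n" unfolding outputs_def by blast
  then obtain a where a: "halted A D a" "\<forall>n<a. \<not> halted A D n" "final_history A D = run A D a"
    by (rule final_history_run)
  then have len: "length (final_history A D) = a" using length_run by metis
  have halt: "A (run A D a) = Halt (graded g Y)"
    using a(1) Y(2) outputs_unique unfolding outputs_def by metis
  let ?N = "card (objects D)"
  \<comment> \<open>This is \<open>k + m * (a + 2) + a\<close>: a bound on the number of objects in
    \<open>Y\<close>, in the first \<open>a + 2\<close> entries of some list, or requested by random
    access. Any further object can serve as \<open>V\<close>.\<close>
  let ?b = "(m + 1) * a + 2 * m + k"
  have "\<exists>r \<le> ?b. \<exists>n \<le> r * (m * m). halted B D n"
  proof (cases "?N \<le> ?b")
    case True
    then show ?thesis using TA_halts_by_length[OF TA] by blast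
  next
    case False
    have "1 * (a + 2) \<le> m * (a + 2)" using m_pos by (rule mult_le_mono1)
    then have small: "a + 2 \<le> ?b" by (simp add: algebra_simps)
    let ?X = "{R. \<exists>i. Random_Access i R \<in> fst ` set (run A D a)}"
    let ?f = "\<lambda>b. case b of Random_Access i R \<Rightarrow> R"
    have sub: "?X \<subseteq> ?f ` set (map fst (run A D a))" by force
    then have finX: "finite ?X" by (rule finite_subset) simp
    have "card ?X \<le> card (?f ` set (map fst (run A D a)))" by (rule card_mono[OF _ sub]) simp
    also have "\<dots> \<le> card (set (map fst (run A D a)))" by (rule card_image_le) simp
    also have "\<dots> \<le> a" using card_length[of "map fst (run A D a)"] len a(3) by simp
    finally have X: "card ?X \<le> a" .
    have "card (top_objects D (a + 2)) \<le> (\<Sum>L\<in>set D. card (fst ` set (take (a + 2) L)))"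
      unfolding top_objects_def by (rule card_UN_le) simp
    also have "\<dots> \<le> (\<Sum>L\<in>set D. a + 2)"
    proof (rule sum_mono)
      fix L
      have "card (fst ` set (take (a + 2) L)) \<le> length (map fst (take (a + 2) L))"
        by (metis card_length list.set_map)
      then show "card (fst ` set (take (a + 2) L)) \<le> a + 2" by simp
    qed
    \<comment> \<open>Only an inequality, since equal lists coincide in
      \<open>set D\<close>.\<close>
    also have "\<dots> \<le> m * (a + 2)"
      using card_length[of D] database(1) by (simp add: mult_le_mono1 del: mult_Suc_right add_2_eq_Suc')
    finally have T: "card (top_objects D (a + 2)) \<le> m * (a + 2)" .
    have finY: "finite Y" "card Y = k" "Y \<subseteq> objects D" using Y(1) by (auto simp: top_k_def)
    have "card (Y \<union> top_objects D (a + 2) \<union> ?X) \<le> k + m * (a + 2) + a"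
      using card_Un_le[of "Y \<union> top_objects D (a + 2)" ?X] card_Un_le[of Y "top_objects D (a + 2)"]
        X T finY by simp
    also have "\<dots> < ?N" using False by (simp add: algebra_simps)
    finally have less: "card (Y \<union> top_objects D (a + 2) \<union> ?X) < ?N" .
    have "\<not> objects D \<subseteq> Y \<union> top_objects D (a + 2) \<union> ?X"
    proof
      assume "objects D \<subseteq> Y \<union> top_objects D (a + 2) \<union> ?X"
      then have "?N \<le> card (Y \<union> top_objects D (a + 2) \<union> ?X)"
        using finX finY finite_top_objects by (intro card_mono) auto
      with less show False by simp
    qed
    then obtain V where V: "V \<in> objects D" "V \<notin> Y" "V \<notin> top_objects D (a + 2)"
        "\<forall>i. Random_Access i V \<notin> fst ` set (run A D a)"
      by blast
    have above: "t (bottom_grades D (a + 2)) < g R" if "R \<in> Y" for R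
      using output_above_threshold[OF strict distinctness correct halt a(2) V _ that] False small
      by simp
    have "Y \<subseteq> {R \<in> top_objects D (a + 2). t (bottom_grades D (a + 2)) \<le> g R}"
    proof
      fix R assume R: "R \<in> Y"
      have "R \<in> top_objects D (a + 2)"
      proof (rule ccontr)
        assume "R \<notin> top_objects D (a + 2)"
        then have "g R \<le> t (bottom_grades D (a + 2))"
          using unseen_below_threshold[of "a + 2" R] R finY(3) by auto
        with above[OF R] show False by simp
      qed
      with above[OF R] show "R \<in> {R \<in> top_objects D (a + 2). t (bottom_grades D (a + 2)) \<le> g R}"
        by simp
    qed
    then have "k \<le> card {R \<in> top_objects D (a + 2). t (bottom_grades D (a + 2)) \<le> g R}"
      using finY(2) card_mono[of _ Y] finite_top_objects by fastforce
    then show ?thesis using TA_halts_by[OF TA] small by blast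
  qed
  then obtain r n where "r \<le> ?b" "n \<le> r * (m * m)" "halted B D n" by blast
  moreover from this have "n \<le> ?b * (m * m)" by (meson le_trans mult_le_mono1)
  ultimately show ?thesis using len by auto
qed

end

theorem theorem6p5:
  fixes m k :: nat and cS cR :: real
    and t :: "real list \<Rightarrow> real"
    and DD :: "'o database set" and AA :: "'o algorithm set"
    and TA :: "'o algorithm"
  assumes "m \<ge> 1" and "k \<ge> 1" and "cS > 0" and "cR > 0"
    and "aggregation_function m t" and "strictly_monotone m t"
    and "DD = {D. is_database m k D \<and> distinctness_property D}"
    and "AA = {A. correct_top_k k t DD A}"
    and "is_TA m k t TA"
  shows "instance_optimal cS cR TA AA DD"
proof -
  have ranking: "ranking m k t D" if "D \<in> DD" for D
    using that assms(1,2,5,7) by (simp add: ranking_def)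
  have "TA \<in> AA"
    unfolding assms(8) correct_top_k_def mem_Collect_eq
    using ranking.TA_correct[OF ranking assms(9)] by blast
  \<comment> \<open>An upper bound on the cost of one round of TA.\<close>
  define C where "C = real (m * m) * max cS cR"
  have "C \<ge> 0" using assms(3) by (simp add: C_def)
  \<comment> \<open>The round bound of \<open>TA_halts_fast\<close> times \<open>C\<close>, with the
    number of accesses of \<open>A\<close> bounded by its cost over \<open>min cS cR\<close>. Both
    constants are independent of \<open>A\<close> and \<open>D\<close>.\<close>
  have "cost cS cR TA D \<le> (m + 1) * C / min cS cR * cost cS cR A D + (2 * m + k) * C"
    if "A \<in> AA" "D \<in> DD" for A D
  proof -
    let ?a = "length (final_history A D)"
    interpret ranking m k t D using ranking[OF that(2)] .
    have "distinctness_property D"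
      and "correct_top_k k t {D. is_database m k D \<and> distinctness_property D} A"
      using that assms(7,8) by simp_all
    then obtain n where n: "n \<le> ((m + 1) * ?a + 2 * m + k) * (m * m)" "halted TA D n"
      using TA_halts_fast[OF assms(6) _ _ assms(9)] by blast
    from n(2) obtain n0 where n0: "n0 \<le> n" "\<forall>n'<n0. \<not> halted TA D n'"
        "final_history TA D = run TA D n0"
      by (rule final_history_run)
    have "length (final_history TA D) \<le> ((m + 1) * ?a + 2 * m + k) * (m * m)"
      unfolding n0(3) length_run[OF n0(2)] using n0(1) n(1) by (rule le_trans)
    then have "real (length (final_history TA D)) \<le> real (((m + 1) * ?a + 2 * m + k) * (m * m))"
      by (simp only: of_nat_le_iff)
    then have "real (length (final_history TA D)) * max cS cR
        \<le> real (((m + 1) * ?a + 2 * m + k) * (m * m)) * max cS cR"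
      using assms(3) by (intro mult_right_mono) auto
    with cost_le_length[of cS cR TA D]
    have "cost cS cR TA D \<le> real (((m + 1) * ?a + 2 * m + k) * (m * m)) * max cS cR"
      by (rule order_trans)
    also have "\<dots> = (m + 1) * C * ?a + (2 * m + k) * C"
      by (simp add: C_def algebra_simps)
    also have "\<dots> \<le> (m + 1) * C * (cost cS cR A D / min cS cR) + (2 * m + k) * C"
      using length_le_cost[of A D cS cR] assms(3,4) \<open>C \<ge> 0\<close>
      by (intro add_right_mono mult_left_mono) (simp_all add: pos_le_divide_eq)
    finally show ?thesis by (simp add: mult.assoc)
  qed
  with \<open>TA \<in> AA\<close> show ?thesis unfolding instance_optimal_def by blast
qed

end
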